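(* Let $P=\frac1{2^3}\delta_1+\frac1{2^2}\delta_2+\frac12\delta_3+\sum_{j=4}^\infty\frac1{2^j}\delta_j$. The set $\{1,2,3,Av[4,5],Av[6,\infty)\}$ forms the optimal set of five-means for $P$ with quantization error $V_5(P)=\frac1{12}$.
   Context: $\delta_x$ denotes the Dirac measure at $x\in\mathbb R$. For a Borel probability measure $P$ on $\mathbb R$ and a nonempty finite set $\alpha\subset\mathbb R$, the distortion error is $V(P;\alpha)=\int\min_{a\in\alpha}|x-a|^2\,dP(x)$. The $n$th quantization error is $V_n(P)=\inf\{V(P;\alpha):\alpha\subset\mathbb R,\ 1\le\mathrm{card}(\alpha)\le n\}$. An optimal set of $n$-means for $P$ is a set $\alpha$ with at most $n$ points for which this infimum is attained. With $p_m=P(\{m\})$ and $i\le\ell$ positive integers, $Av[i,\ell]=\frac{\sum_{m=i}^{\ell}p_m m}{\sum_{m=i}^{\ell}p_m}$ and $Av[i,\infty)=\frac{\sum_{m=i}^{\infty}p_m m}{\sum_{m=i}^{\infty}p_m}$. *)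

theory Defs
  imports "HOL-Probability.Probability"
begin

text \<open>
  The distortion error is taken in \<^typ>\<open>ennreal\<close>, so that it is meaningful (namely infinite) for
  measures without a second moment; a Bochner integral would be \<open>0\<close> there and spoil the infimum.
\<close>

definition distortion :: "real measure \<Rightarrow> real set \<Rightarrow> ennreal" where
  "distortion P \<alpha> = (\<integral>\<^sup>+ x. ennreal (Min ((\<lambda>a. \<bar>x - a\<bar>\<^sup>2) ` \<alpha>)) \<partial>P)"

definition quantization_error :: "nat \<Rightarrow> real measure \<Rightarrow> ennreal" where
  "quantization_error n P = (INF \<alpha> \<in> {\<alpha>. finite \<alpha> \<and> 1 \<le> card \<alpha> \<and> card \<alpha> \<le> n}. distortion P \<alpha>)"

definition optimal_set_of_means :: "nat \<Rightarrow> real measure \<Rightarrow> real set \<Rightarrow> bool" where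
  "optimal_set_of_means n P \<alpha> \<longleftrightarrow>
     finite \<alpha> \<and> 1 \<le> card \<alpha> \<and> card \<alpha> \<le> n \<and> distortion P \<alpha> = quantization_error n P"

definition Av :: "real measure \<Rightarrow> nat \<Rightarrow> nat \<Rightarrow> real" where
  "Av P i l = (\<Sum>m=i..l. measure P {real m} * real m) / (\<Sum>m=i..l. measure P {real m})"

text \<open>The series over \<open>m \<ge> i\<close> is indexed by \<open>k\<close> with \<open>m = i + k\<close>.\<close>

definition Av_inf :: "real measure \<Rightarrow> nat \<Rightarrow> real" where
  "Av_inf P i =
     (\<Sum>k. measure P {real (i + k)} * real (i + k)) / (\<Sum>k. measure P {real (i + k)})"

text \<open>
  \<^term>\<open>return borel x\<close> is the Dirac measure at \<open>x\<close>. As \<^const>\<open>measure_of\<close> silently yields the null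
  measure when its last argument is not countably additive, \<open>emeasure_P\<close> and \<open>prob_space_P\<close>
  below confirm that \<open>P\<close> is the intended measure.
\<close>

definition P :: "real measure" where
  "P = measure_of UNIV (sets borel) (\<lambda>A.
     ennreal (1 / 2^3) * emeasure (return borel 1) A
     + ennreal (1 / 2^2) * emeasure (return borel 2) A
     + ennreal (1 / 2) * emeasure (return borel 3) A
     + (\<Sum>k. ennreal (1 / 2^(4 + k)) * emeasure (return borel (real (4 + k))) A))"

lemma space_P [simp]: "space P = UNIV"
  by (simp add: P_def space_measure_of_conv)

lemma sets_P [simp, measurable_cong]: "sets P = sets borel"
  using sets.sigma_sets_eq[of "borel :: real measure"]
  by (simp add: P_def sets_measure_of_conv)

lemma emeasure_P:
  assumes "A \<in> sets borel"
  shows "emeasure P A =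
     ennreal (1 / 2^3) * emeasure (return borel 1) A
     + ennreal (1 / 2^2) * emeasure (return borel 2) A
     + ennreal (1 / 2) * emeasure (return borel 3) A
     + (\<Sum>k. ennreal (1 / 2^(4 + k)) * emeasure (return borel (real (4 + k))) A)"
proof (rule emeasure_measure_of[OF P_def])
  show "countably_additive (sets P) (\<lambda>A.
     ennreal (1 / 2^3) * emeasure (return borel 1) A
     + ennreal (1 / 2^2) * emeasure (return borel 2) A
     + ennreal (1 / 2) * emeasure (return borel 3) A
     + (\<Sum>k. ennreal (1 / 2^(4 + k)) * emeasure (return borel (real (4 + k))) A))"
  proof (rule countably_additiveI)
    fix B :: "nat \<Rightarrow> real set"
    assume "range B \<subseteq> sets P" and disj: "disjoint_family B"
    then have B: "range B \<subseteq> sets borel"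
      by simp
    have ret: "emeasure (return borel x) (\<Union>i. B i) = (\<Sum>i. emeasure (return borel x) (B i))"
      for x :: real
      by (rule suminf_emeasure[symmetric]) (use B disj in auto)
    have swap: "(\<Sum>k. \<Sum>i. f k i) = (\<Sum>i. \<Sum>k. f k i)" for f :: "nat \<Rightarrow> nat \<Rightarrow> ennreal"
      using nn_integral_suminf[of "\<lambda>i k. f k i" "count_space UNIV"]
      by (simp add: nn_integral_count_space_nat)
    have add: "(\<Sum>i. f i + g i) = (\<Sum>i. f i) + (\<Sum>i. g i)" for f g :: "nat \<Rightarrow> ennreal"
      by (rule suminf_add[symmetric]) auto
    show "(\<Sum>i. ennreal (1 / 2^3) * emeasure (return borel 1) (B i)
        + ennreal (1 / 2^2) * emeasure (return borel 2) (B i)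
        + ennreal (1 / 2) * emeasure (return borel 3) (B i)
        + (\<Sum>k. ennreal (1 / 2^(4 + k)) * emeasure (return borel (real (4 + k))) (B i)))
      = ennreal (1 / 2^3) * emeasure (return borel 1) (\<Union>i. B i)
        + ennreal (1 / 2^2) * emeasure (return borel 2) (\<Union>i. B i)
        + ennreal (1 / 2) * emeasure (return borel 3) (\<Union>i. B i)
        + (\<Sum>k. ennreal (1 / 2^(4 + k)) * emeasure (return borel (real (4 + k))) (\<Union>i. B i))"
      unfolding ret ennreal_suminf_cmult[symmetric] add
      by (subst swap) (rule refl)
  qed
qed (use assms in \<open>auto simp: positive_def\<close>)

lemma prob_space_P: "prob_space P"
proof (rule prob_spaceI)
  have "(\<lambda>k. 1 / 2^(4 + k) :: real) sums (1 / 8)"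
    using sums_mult[OF geometric_sums[of "1 / 2 :: real"], of "1 / 16"]
    by (simp add: power_add power_one_over)
  then have "(\<Sum>k. ennreal (1 / 2^(4 + k))) = ennreal (1 / 8)"
    by (intro suminf_ennreal_eq) auto
  moreover have "emeasure (return borel x) UNIV = 1" for x :: real
    by simp
  ultimately have "emeasure P (space P)
      = ennreal (1 / 2^3) + ennreal (1 / 2^2) + ennreal (1 / 2) + ennreal (1 / 8)"
    using emeasure_P[of UNIV] by (simp only: space_P mult_1_right borel_open open_UNIV)
  also have "\<dots> = ennreal (1 / 2^3 + 1 / 2^2 + 1 / 2 + 1 / 8)"
    by (simp only: ennreal_plus add_nonneg_nonneg zero_le_divide_1_iff zero_le_power zero_le_numeral)
  finally show "emeasure P (space P) = 1"
    by simp
qed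

end

theory Submission
  imports Defs "HOL-Real_Asymp.Real_Asymp"
begin

text \<open>
  The mass of \<open>P\<close> at 1, 2, 3 is so large that a point shared as nearest point by 1, 2, by 2, 3 or by
  3, 4, 5 already costs at least \<open>1/12\<close>. A point shared just by 3, 4 costs at least \<open>1/18\<close>, and then the
  tail from 5 on is left to two points, which costs at least \<open>1/24\<close> more. Otherwise 1, 2, 3 have private
  nearest points and the tail from 4 on is left to two points. The weights of that tail are
  geometric, and there completing squares in each of the possible splittings shows that the split
  \<open>{4, 5}\<close>, \<open>{6, 7, \<dots>}\<close> is the unique best one, at cost \<open>1/12\<close>.
\<close>

section \<open>Atoms of \<open>P\<close> and integration as a series\<close>

text \<open>Total on the naturals, with weight 0 at 0, so that every integral against
  \<open>P\<close> is one series over all naturals.\<close>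

definition mass :: "nat \<Rightarrow> real" where
  "mass n = (if n = 0 then 0 else if n = 1 then 1/8 else if n = 2 then 1/4
             else if n = 3 then 1/2 else 1 / 2^n)"

lemma mass_nonneg [simp]: "mass n \<ge> 0"
  by (simp add: mass_def)

lemma mass_tail: "n \<ge> 4 \<Longrightarrow> mass n = 1 / 2^n"
  by (simp add: mass_def)

lemma mass_small [simp]:
  "mass 0 = 0" "mass (Suc 0) = 1/8" "mass 2 = 1/4" "mass 3 = 1/2" "mass 4 = 1/16" "mass 5 = 1/32"
  by (simp_all add: mass_def)

text \<open>Seen as the image of a weighted counting measure, \<open>P\<close> inherits the
  integration rules for \<open>distr\<close> and \<open>density\<close>.\<close>

lemma P_eq_distr: "P = distr (density (count_space UNIV) (\<lambda>n. ennreal (mass n))) borel real"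
proof (rule measure_eqI)
  fix A assume "A \<in> sets P"
  then have A: "A \<in> sets borel" by simp
  define f where "f n = ennreal (mass n) * indicator A (real n)" for n
  have "emeasure (distr (density (count_space UNIV) (\<lambda>n. ennreal (mass n))) borel real) A
      = (\<Sum>n. f n)"
    using A
    by (simp add: f_def emeasure_distr emeasure_density nn_integral_count_space_nat indicator_def
        vimage_def)
  also have "\<dots> = (\<Sum>n. f (n + 4)) + sum f {..<4}"
    by (rule suminf_offset) (rule summableI)
  also have "sum f {..<4} = f 1 + f 2 + f 3"
  proof -
    have "{..<4} = {0, 1, 2, 3 :: nat}" by auto
    moreover have "f 0 = 0" by (simp add: f_def)
    ultimately show ?thesis by (simp add: add_ac)
  qed
  finally show "emeasure P A
      = emeasure (distr (density (count_space UNIV) (\<lambda>n. ennreal (mass n))) borel real) A"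
    using A by (simp add: emeasure_P f_def mass_tail add_ac)
qed simp

lemma nn_integral_P:
  assumes [measurable]: "g \<in> borel_measurable borel"
  shows "(\<integral>\<^sup>+ x. g x \<partial>P) = (\<Sum>n. ennreal (mass n) * g (real n))"
  by (simp add: P_eq_distr nn_integral_distr nn_integral_density nn_integral_count_space_nat)

lemma measure_P_singleton: "measure P {real m} = mass m"
proof -
  have "emeasure P {real m} = (\<integral>\<^sup>+ x. indicator {real m} x \<partial>P)"
    by simp
  also have "\<dots> = (\<Sum>n. ennreal (mass n) * indicator {real m} (real n))"
    by (rule nn_integral_P) simp
  also have "\<dots> = (\<Sum>n\<in>{m}. ennreal (mass n) * indicator {real m} (real n))"
    by (rule suminf_finite) (auto simp: indicator_def)
  finally show ?thesis
    by (simp add: measure_def)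
qed

section \<open>Geometric series and the two averages\<close>

text \<open>The weights \<open>(1/2)^k\<close> have total 2, mean 1 and normalized variance 2,
  whence \<open>2 * (2 + (t - 1)\<^sup>2)\<close>. The remainder after \<open>n\<close> terms is the
  same series with \<open>t - n\<close> for \<open>t\<close>, scaled by \<open>(1/2)^n\<close>; this
  gives the partial sums by induction.\<close>

lemma sums_half_quadratic:
  fixes t :: real
  shows "(\<lambda>k. (1/2)^k * (real k - t)\<^sup>2) sums (4 + 2 * (t - 1)\<^sup>2)"
proof -
  have "(\<Sum>k<n. (1/2)^k * (real k - t)\<^sup>2)
      = (4 + 2 * (t - 1)\<^sup>2) - (1/2)^n * (4 + 2 * (t - real n - 1)\<^sup>2)" for n
    by (induction n) (simp_all add: algebra_simps power2_eq_square)
  moreover have "(\<lambda>n. (4 + 2 * (t - 1)\<^sup>2) - (1/2)^n * (4 + 2 * (t - real n - 1)\<^sup>2))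
      \<longlonglongrightarrow> (4 + 2 * (t - 1)\<^sup>2)"
    by real_asymp
  ultimately show ?thesis
    by (simp add: sums_def)
qed

lemma sums_half_linear: "(\<lambda>k. (1/2)^k * real k) sums (2 :: real)"
proof -
  have "(\<Sum>k<n. (1/2)^k * real k) = 2 - (1/2)^n * (2 + 2 * real n)" for n
    by (induction n) (simp_all add: algebra_simps add_divide_distrib)
  moreover have "(\<lambda>n. 2 - (1/2)^n * (2 + 2 * real n)) \<longlonglongrightarrow> (2 :: real)"
    by real_asymp
  ultimately show ?thesis
    by (simp add: sums_def)
qed

lemma Av_4_5: "Av P 4 5 = 13/3"
proof -
  have "{4..5::nat} = {4, 5}" by auto
  then show ?thesis
    by (simp add: Av_def measure_P_singleton)
qed

lemma Av_inf_6: "Av_inf P 6 = 7"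
proof -
  have half: "(\<lambda>k. (1/2)^k) sums (2 :: real)"
    using geometric_sums[of "1/2 :: real"] by simp
  have "(\<lambda>k. 1/64 * ((1/2)^k * real k + 6 * (1/2)^k)) sums (1/64 * (2 + 6 * 2))"
    by (intro sums_mult sums_add sums_half_linear half)
  then have num: "(\<Sum>k. measure P {real (6 + k)} * real (6 + k)) = 1/64 * (2 + 6 * 2)"
    by (intro sums_unique[symmetric])
      (unfold measure_P_singleton, simp add: mass_tail power_add power_one_over field_simps)
  have "(\<lambda>k. 1/64 * (1/2)^k) sums (1/64 * 2 :: real)"
    by (intro sums_mult half)
  then have "(\<Sum>k. measure P {real (6 + k)}) = 1/64 * 2"
    by (intro sums_unique[symmetric])
      (unfold measure_P_singleton, simp add: mass_tail power_add power_one_over field_simps)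
  then show ?thesis
    unfolding Av_inf_def num by (simp only:) simp
qed

section \<open>Two means for geometric weights\<close>

text \<open>Geometric weights are self-similar: from \<open>m\<close> on they are the original ones
  scaled by \<open>(1/2)^m\<close>, with \<open>c\<close> moved to \<open>c - m\<close>.\<close>

lemma half_quadratic_tail:
  assumes "\<And>k. k \<ge> m \<Longrightarrow> D k = (real k - c)\<^sup>2"
  shows "summable (\<lambda>k. (1/2)^k * D k)"
    and "(\<Sum>k. (1/2)^k * D k)
       = (\<Sum>k<m. (1/2)^k * D k) + (1/2)^m * (4 + 2 * (c - real m - 1)\<^sup>2)"
proof -
  have "(\<lambda>k. (1/2)^m * ((1/2)^k * (real k - (c - real m))\<^sup>2))
      sums ((1/2)^m * (4 + 2 * (c - real m - 1)\<^sup>2))"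
    by (intro sums_mult sums_half_quadratic)
  then have tail: "(\<lambda>k. (1/2)^(k + m) * D (k + m))
      sums ((1/2)^m * (4 + 2 * (c - real m - 1)\<^sup>2))"
    by (simp add: assms power_add algebra_simps)
  then show sm: "summable (\<lambda>k. (1/2)^k * D k)"
    using summable_iff_shift[of "\<lambda>k. (1/2)^k * D k" m] by (simp add: sums_iff)
  show "(\<Sum>k. (1/2)^k * D k)
       = (\<Sum>k<m. (1/2)^k * D k) + (1/2)^m * (4 + 2 * (c - real m - 1)\<^sup>2)"
    using suminf_split_initial_segment[OF sm, of m] sums_unique[OF tail] by simp
qed

text \<open>The two cells meet at the midpoint \<open>(b + c) / 2\<close>, so its position relative
  to 1, 2 and 3 decides which atoms \<open>b\<close> serves. In each position the cost is bounded
  below by completing squares or dropping nonnegative terms.\<close>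

lemma geometric_two_means:
  fixes b c :: real
  assumes "b \<le> c" and D: "\<And>k. D k = min ((real k - b)\<^sup>2) ((real k - c)\<^sup>2)"
  shows "(\<Sum>k. (1/2)^k * D k) \<ge> 4/3"
    and "(\<Sum>k. (1/2)^k * D k) = 4/3 \<Longrightarrow> b = 1/3 \<and> c = 3"
proof -
  let ?S = "\<Sum>k. (1/2)^k * D k"
  have diff: "(x - b)\<^sup>2 - (x - c)\<^sup>2 = (c - b) * (2 * x - b - c)" for x
    by (simp add: power2_eq_square algebra_simps)
  have left: "D k = (real k - b)\<^sup>2" if "2 * real k \<le> b + c" for k
  proof -
    have "(c - b) * (2 * real k - b - c) \<le> 0"
      using assms(1) that by (intro mult_nonneg_nonpos) auto
    then show ?thesis using diff[of "real k"] D[of k] by (simp add: min.absorb1)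
  qed
  have right: "D k = (real k - c)\<^sup>2" if "2 * real k \<ge> b + c" for k
  proof -
    have "(c - b) * (2 * real k - b - c) \<ge> 0"
      using assms(1) that by (intro mult_nonneg_nonneg) auto
    then show ?thesis using diff[of "real k"] D[of k] by (simp add: min.absorb2)
  qed
  have D0: "D k \<ge> 0" for k
    using D[of k] by simp
  \<comment> \<open>Any \<open>m\<close> beyond the midpoint will do here: from there on
    \<open>c\<close> serves every atom, which settles summability.\<close>
  obtain m :: nat where "(b + c) / 2 < real m"
    using reals_Archimedean2 by blast
  then have m: "2 * real m \<ge> b + c" by simp
  have sm: "summable (\<lambda>k. (1/2)^k * D k)"
    by (rule half_quadratic_tail(1)[of m _ c]) (use right m in auto)
  have split: "?S = (\<Sum>k<m. (1/2)^k * D k) + (1/2)^m * (4 + 2 * (c - real m - 1)\<^sup>2)"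
    if "2 * real m \<ge> b + c" for m
    by (rule half_quadratic_tail(2)) (use right that in auto)
  consider "b + c \<le> 2" | "2 \<le> b + c" "b + c \<le> 4" | "4 \<le> b + c" "b + c \<le> 6" | "6 \<le> b + c"
    by linarith
  then have or: "?S > 4/3 \<or> ?S = 3/2 * (b - 1/3)\<^sup>2 + 1/2 * (c - 3)\<^sup>2 + 4/3"
  proof cases
    case 1
    \<comment> \<open>Here \<open>c\<close> serves everything from 1 on, at cost at least 2
      already.\<close>
    then have "?S = D 0 + 2 + (c - 2)\<^sup>2" using split[of 1] by simp
    then have "?S \<ge> 2" using D0[of 0] by simp
    then show ?thesis by simp
  next
    case 2
    have "{..<2::nat} = {0, 1}" by auto
    \<comment> \<open>The atoms 0 and 1, with weights 1 and 1/2, have total weight 3/2 and mean 1/3;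
      the tail from 2 has mean 3. Only this case can reach 4/3, so these means are the unique
      minimiser.\<close>
    then have "(\<Sum>k<2. (1/2)^k * D k) = 3/2 * (b - 1/3)\<^sup>2 + 1/3"
      using left[of 0] left[of 1] 2 by (simp add: power2_eq_square field_simps)
    then have "?S = 3/2 * (b - 1/3)\<^sup>2 + 1/2 * (c - 3)\<^sup>2 + 4/3"
      using split[of 2] 2 by (simp add: power_one_over add_divide_distrib)
    then show ?thesis ..
  next
    case 3
    have "{..<3::nat} = {0, 1, 2}" by auto
    then have "(\<Sum>k<3. (1/2)^k * D k) = 7/4 * (b - 4/7)\<^sup>2 + 13/14"
      using left[of 0] left[of 1] left[of 2] 3
      by (simp add: power2_eq_square field_simps)
    then have "?S = 7/4 * (b - 4/7)\<^sup>2 + 13/14 + 1/8 * (4 + 2 * (c - 4)\<^sup>2)"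
      using split[of 3] 3 by (simp add: power3_eq_cube)
    then have "?S \<ge> 13/14 + 1/2"
      using zero_le_power2[of "b - 4/7"] zero_le_power2[of "c - 4"] by argo
    then show ?thesis by simp
  next
    case 4
    have "{..<4::nat} = {0, 1, 2, 3}" by auto
    then have "(\<Sum>k<4. (1/2)^k * D k) = 15/8 * (b - 11/15)\<^sup>2 + 97/60"
      using left[of 0] left[of 1] left[of 2] left[of 3] 4
      by (simp add: power2_eq_square power3_eq_cube field_simps)
    \<comment> \<open>The midpoint may be arbitrarily far right, but the first four atoms served by
      \<open>b\<close> already cost too much.\<close>
    moreover have "(\<Sum>k<4. (1/2)^k * D k) \<le> ?S"
      by (rule sum_le_suminf[OF sm]) (use D0 in auto)
    ultimately have "?S \<ge> 97/60"
      using zero_le_power2[of "b - 11/15"] by linarith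
    then show ?thesis by simp
  qed
  moreover have "3/2 * (b - 1/3)\<^sup>2 + 1/2 * (c - 3)\<^sup>2 + 4/3 \<ge> 4/3" by simp
  ultimately show "?S \<ge> 4/3" by linarith
  assume "?S = 4/3"
  with or have "3/2 * (b - 1/3)\<^sup>2 + 1/2 * (c - 3)\<^sup>2 = 0" by linarith
  then have "(b - 1/3)\<^sup>2 = 0" "(c - 3)\<^sup>2 = 0"
    using zero_le_power2[of "b - 1/3"] zero_le_power2[of "c - 3"] by linarith+
  then show "b = 1/3 \<and> c = 3" by simp
qed

section \<open>Nearest points and real-valued cost\<close>

definition sq_dist :: "real set \<Rightarrow> real \<Rightarrow> real" where
  "sq_dist \<beta> x = Min ((\<lambda>a. \<bar>x - a\<bar>\<^sup>2) ` \<beta>)"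

text \<open>Set-valued to allow ties: if two of these sets are disjoint, any choices from them are
  distinct.\<close>

definition nearest :: "real set \<Rightarrow> real \<Rightarrow> real set" where
  "nearest \<beta> x = {a \<in> \<beta>. (x - a)\<^sup>2 = sq_dist \<beta> x}"

definition cost :: "real set \<Rightarrow> real" where
  "cost \<beta> = (\<Sum>n. mass n * sq_dist \<beta> (real n))"

lemma sq_dist_le: "finite \<beta> \<Longrightarrow> a \<in> \<beta> \<Longrightarrow> sq_dist \<beta> x \<le> (x - a)\<^sup>2"
  unfolding sq_dist_def by (intro Min_le) (auto intro!: image_eqI[of _ _ a])

lemma nearest_nonempty:
  assumes "finite \<beta>" "\<beta> \<noteq> {}"
  shows "nearest \<beta> x \<noteq> {}"
proof -
  have "sq_dist \<beta> x \<in> (\<lambda>a. \<bar>x - a\<bar>\<^sup>2) ` \<beta>"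
    unfolding sq_dist_def using assms by (intro Min_in) auto
  then show ?thesis
    by (auto simp: nearest_def)
qed

lemma sq_dist_nonneg: "finite \<beta> \<Longrightarrow> \<beta> \<noteq> {} \<Longrightarrow> sq_dist \<beta> x \<ge> 0"
  unfolding sq_dist_def by (subst Min_ge_iff) auto

lemma sq_dist_pos:
  assumes "finite \<beta>" "\<beta> \<noteq> {}" "x \<notin> \<beta>"
  shows "sq_dist \<beta> x > 0"
  unfolding sq_dist_def using assms by (subst Min_gr_iff) auto

text \<open>Cells are intervals: for each competitor \<open>e\<close>, the difference of the squared
  distances to \<open>e\<close> and to \<open>a\<close> is affine in the position, so if it is
  nonnegative at \<open>x\<close> and \<open>z\<close> it is so at \<open>y\<close>.\<close>

lemma nearest_between:
  assumes "finite \<beta>" "a \<in> nearest \<beta> x" "a \<in> nearest \<beta> z" "x \<le> y" "y \<le> z"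
  shows "a \<in> nearest \<beta> y"
proof -
  have a: "a \<in> \<beta>" using assms by (simp add: nearest_def)
  have le: "(y - a)\<^sup>2 \<le> (y - e)\<^sup>2" if e: "e \<in> \<beta>" for e
  proof -
    have diff: "(w - e)\<^sup>2 - (w - a)\<^sup>2 = (e - a) * (e + a - 2 * w)" for w
      by (simp add: power2_eq_square algebra_simps)
    have "(e - a) * (e + a - 2 * w) \<ge> 0" if "a \<in> nearest \<beta> w" for w
      using sq_dist_le[OF assms(1) e, of w] that diff[of w] by (simp add: nearest_def)
    then have "(e - a) * (e + a - 2 * x) \<ge> 0" "(e - a) * (e + a - 2 * z) \<ge> 0"
      using assms by auto
    then have "(e - a) * (e + a - 2 * y) \<ge> 0"
      using assms(4,5) by (auto simp: zero_le_mult_iff)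
    then show ?thesis using diff[of y] by linarith
  qed
  obtain e where "e \<in> nearest \<beta> y"
    using nearest_nonempty[OF assms(1), of y] a by auto
  then show ?thesis
    using le[of e] sq_dist_le[OF assms(1) a, of y] a by (auto simp: nearest_def)
qed

lemma summable_cost:
  assumes "finite \<beta>" "\<beta> \<noteq> {}"
  shows "summable (\<lambda>n. mass n * sq_dist \<beta> (real n))"
proof -
  obtain a where a: "a \<in> \<beta>" using assms by auto
  show ?thesis
  proof (rule summable_comparison_test')
    show "summable (\<lambda>k. (1/2)^k * (real k - a)\<^sup>2)"
      using sums_half_quadratic by (rule sums_summable)
    show "norm (mass n * sq_dist \<beta> (real n)) \<le> (1/2)^n * (real n - a)\<^sup>2" if "n \<ge> 4" for n
      using that sq_dist_le[OF assms(1) a, of "real n"] sq_dist_nonneg[OF assms, of "real n"]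
      by (auto simp: mass_tail power_one_over abs_mult field_simps)
  qed
qed

lemma sum_le_cost:
  assumes "finite \<beta>" "\<beta> \<noteq> {}" "finite I"
  shows "(\<Sum>n\<in>I. mass n * sq_dist \<beta> (real n)) \<le> cost \<beta>"
  unfolding cost_def
  by (rule sum_le_suminf[OF summable_cost]) (use assms sq_dist_nonneg in auto)

lemma distortion_P:
  assumes "finite \<beta>" "\<beta> \<noteq> {}"
  shows "distortion P \<beta> = ennreal (cost \<beta>)"
proof -
  have "(\<lambda>x. Min ((\<lambda>a. \<bar>x - a\<bar>\<^sup>2) ` \<beta>)) \<in> borel_measurable borel"
    using assms by (intro borel_measurable_Min) auto
  then have [measurable]: "sq_dist \<beta> \<in> borel_measurable borel"
    by (simp add: sq_dist_def[abs_def])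
  have "distortion P \<beta> = (\<integral>\<^sup>+ x. ennreal (sq_dist \<beta> x) \<partial>P)"
    by (simp add: distortion_def sq_dist_def)
  also have "\<dots> = (\<Sum>n. ennreal (mass n) * ennreal (sq_dist \<beta> (real n)))"
    by (rule nn_integral_P) measurable
  also have "\<dots> = (\<Sum>n. ennreal (mass n * sq_dist \<beta> (real n)))"
    using assms by (simp add: ennreal_mult sq_dist_nonneg)
  also have "\<dots> = ennreal (cost \<beta>)"
    unfolding cost_def
    by (rule suminf_ennreal2) (use assms summable_cost sq_dist_nonneg in auto)
  finally show ?thesis .
qed

section \<open>Lower bound and uniqueness for five points\<close>

text \<open>From 4 on the weights are purely geometric, so the tail, moved to start at 0, has the
  form treated by \<open>geometric_two_means\<close>.\<close>

lemma cost_split: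
  assumes "finite \<beta>" "\<beta> \<noteq> {}" "s \<ge> 4"
  shows "cost \<beta> = (\<Sum>n<s. mass n * sq_dist \<beta> (real n))
    + (1/2)^s * (\<Sum>k. (1/2)^k * sq_dist \<beta> (real (s + k)))"
proof -
  have "mass (n + s) * sq_dist \<beta> (real (n + s))
      = (1/2)^s * ((1/2)^n * sq_dist \<beta> (real (s + n)))" for n
    using assms(3) by (simp add: mass_tail power_add power_one_over add_ac)
  moreover from this have "summable (\<lambda>n. (1/2)^n * sq_dist \<beta> (real (s + n)))"
    using summable_ignore_initial_segment[OF summable_cost[OF assms(1,2)], of s] by simp
  ultimately show ?thesis
    unfolding cost_def using suminf_split_initial_segment[OF summable_cost[OF assms(1,2)], of s]
    by (simp add: suminf_mult)
qed

text \<open>If neither 1, 2 nor 2, 3 share a nearest point, then 1, 2, 3 use up three of the five points,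
  so that at most two are left for the tail.\<close>

lemma tail_two_means:
  assumes fin: "finite \<beta>" and ne: "\<beta> \<noteq> {}" and card: "card \<beta> \<le> 5" and s: "s \<ge> 4"
    and no12: "nearest \<beta> 1 \<inter> nearest \<beta> 2 = {}" and no23: "nearest \<beta> 2 \<inter> nearest \<beta> 3 = {}"
    and no3s: "nearest \<beta> 3 \<inter> nearest \<beta> (real s) = {}"
  obtains a1 a2 a3 b c where
    "a1 \<in> nearest \<beta> 1" "a2 \<in> nearest \<beta> 2" "a3 \<in> nearest \<beta> 3" "\<beta> = {a1, a2, a3, b, c}"
    "(\<Sum>k. (1/2)^k * sq_dist \<beta> (real (s + k))) \<ge> 4/3"
    "(\<Sum>k. (1/2)^k * sq_dist \<beta> (real (s + k))) = 4/3 \<Longrightarrow> b = real s + 1/3 \<and> c = real s + 3"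
proof -
  obtain a1 a2 a3 where a: "a1 \<in> nearest \<beta> 1" "a2 \<in> nearest \<beta> 2" "a3 \<in> nearest \<beta> 3"
    using nearest_nonempty[OF fin ne] by blast
  then have a\<beta>: "a1 \<in> \<beta>" "a2 \<in> \<beta>" "a3 \<in> \<beta>" by (auto simp: nearest_def)
  have "a1 \<noteq> a2" "a2 \<noteq> a3" using a no12 no23 by auto
  \<comment> \<open>A point nearest to both 1 and 3 would also be nearest to 2, which
    \<open>no12\<close> excludes.\<close>
  moreover have "a1 \<noteq> a3"
    using nearest_between[OF fin, of a1 1 3 2] a no12 by auto
  ultimately have c3: "card {a1, a2, a3} = 3" by simp
  define T where "T = \<beta> - {a1, a2, a3}"
  have "card T = card \<beta> - card {a1, a2, a3}"
    unfolding T_def by (rule card_Diff_subset) (use a\<beta> in auto)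
  then have cT: "card T \<le> 2" using c3 card by simp
  \<comment> \<open>A point serving \<open>s + k\<close> and 3 would serve \<open>s\<close> as well.
    Serving 2 would force serving 3, and serving 1 would force serving 2, because cells are
    intervals.\<close>
  have near: "nearest \<beta> (real (s + k)) \<subseteq> T" for k
  proof
    fix x assume x: "x \<in> nearest \<beta> (real (s + k))"
    have "x \<notin> nearest \<beta> 3"
      using nearest_between[OF fin _ x, of 3 "real s"] no3s s by auto
    moreover from this have "x \<notin> nearest \<beta> 2"
      using nearest_between[OF fin _ x, of 2 3] s by auto
    moreover from this have "x \<notin> nearest \<beta> 1"
      using nearest_between[OF fin _ x, of 1 2] s by auto
    ultimately show "x \<in> T"
      using x a by (auto simp: T_def nearest_def)
  qed
  have "T \<noteq> {}" using near[of 0] nearest_nonempty[OF fin ne, of "real (s + 0)"] by blast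
  \<comment> \<open>If only one point is left, \<open>b = c\<close>.\<close>
  have "\<exists>b c. b \<le> c \<and> T = {b, c}"
  proof -
    have "finite T" using fin by (simp add: T_def)
    then have "card T \<noteq> 0" using \<open>T \<noteq> {}\<close> by simp
    with cT consider "card T = 1" | "card T = 2" by linarith
    then show ?thesis
    proof cases
      case 1
      then show ?thesis by (metis card_1_singletonE insert_absorb2 order_refl)
    next
      case 2
      then show ?thesis by (metis card_2_iff insert_commute linear)
    qed
  qed
  then obtain b c where bc: "b \<le> c" "T = {b, c}" by blast
  have \<beta>: "\<beta> = {a1, a2, a3, b, c}" using a\<beta> bc(2) by (auto simp: T_def)
  have D: "sq_dist \<beta> (real (s + k)) = min ((real k - (b - real s))\<^sup>2) ((real k - (c - real s))\<^sup>2)"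
    for k
  proof -
    obtain x where "x \<in> nearest \<beta> (real (s + k))" using nearest_nonempty[OF fin ne] by blast
    moreover from this have "x \<in> {b, c}" using near bc by blast
    moreover have "sq_dist \<beta> (real (s + k)) \<le> (real (s + k) - b)\<^sup>2"
      "sq_dist \<beta> (real (s + k)) \<le> (real (s + k) - c)\<^sup>2"
      using \<beta> fin by (auto intro: sq_dist_le)
    ultimately show ?thesis
      by (auto simp: nearest_def min_def algebra_simps)
  qed
  have le: "b - real s \<le> c - real s" using bc by simp
  show ?thesis
  proof (rule that[OF a \<beta>])
    show "(\<Sum>k. (1/2)^k * sq_dist \<beta> (real (s + k))) \<ge> 4/3"
      by (rule geometric_two_means(1)[OF le D])
    show "b = real s + 1/3 \<and> c = real s + 3"
      if "(\<Sum>k. (1/2)^k * sq_dist \<beta> (real (s + k))) = 4/3"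
      using geometric_two_means(2)[OF le D that] by linarith
  qed
qed

lemma cost_five_means:
  assumes fin: "finite \<beta>" and ne: "\<beta> \<noteq> {}" and card: "card \<beta> \<le> 5"
  shows "cost \<beta> > 1/12 \<or> cost \<beta> = 1/12 \<and> \<beta> = {1, 2, 3, 13/3, 7}"
proof -
  let ?d = "\<lambda>n. sq_dist \<beta> (real n)"
  note nonneg = sq_dist_nonneg[OF fin ne]
  have near: "sq_dist \<beta> x = (x - a)\<^sup>2" if "a \<in> nearest \<beta> x" for a x
    using that by (simp add: nearest_def)
  have init: "(\<Sum>n<4. mass n * ?d n) = 1/8 * ?d 1 + 1/4 * ?d 2 + 1/2 * ?d 3"
  proof -
    have "{..<4::nat} = {0, 1, 2, 3}" by auto
    then show ?thesis by simp
  qed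
  have init': "(\<Sum>n<5. mass n * ?d n) = (\<Sum>n<4. mass n * ?d n) + 1/16 * ?d 4"
    using sum.lessThan_Suc[of "\<lambda>n. mass n * ?d n" 4] by simp
  show ?thesis
  proof (cases "nearest \<beta> 1 \<inter> nearest \<beta> 2 = {}")
    case False
    then obtain a where a: "a \<in> nearest \<beta> 1" "a \<in> nearest \<beta> 2" by auto
    \<comment> \<open>The atoms 1 and 2 alone can cost exactly 1/12, namely at their weighted mean
      5/3. Strictness comes from a further atom \<open>n\<close> that the finite set
      \<open>\<beta>\<close> misses.\<close>
    have "infinite (real ` {4..})"
      by (simp add: finite_image_iff infinite_Ici)
    then have "\<not> real ` {4..} \<subseteq> \<beta>"
      using fin finite_subset by blast
    then obtain n where n: "n \<ge> 4" "real n \<notin> \<beta>" by auto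
    have "(\<Sum>k\<in>{1,2,n}. mass k * ?d k) \<le> cost \<beta>"
      by (rule sum_le_cost) (use fin ne in auto)
    moreover have "mass n * ?d n > 0"
      using sq_dist_pos[OF fin ne n(2)] n(1) by (simp add: mass_tail)
    ultimately have "1/8 * (1 - a)\<^sup>2 + 1/4 * (2 - a)\<^sup>2 < cost \<beta>"
      using n near[OF a(1)] near[OF a(2)] by simp
    moreover have "1/8 * (1 - a)\<^sup>2 + 1/4 * (2 - a)\<^sup>2 = 3/8 * (a - 5/3)\<^sup>2 + 1/12"
      by (simp add: power2_eq_square field_simps)
    ultimately show ?thesis using zero_le_power2[of "a - 5/3"] by linarith
  next
    case no12: True
    show ?thesis
    proof (cases "nearest \<beta> 2 \<inter> nearest \<beta> 3 = {}")
      case False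
      then obtain a where a: "a \<in> nearest \<beta> 2" "a \<in> nearest \<beta> 3" by auto
      have "(\<Sum>k\<in>{2,3}. mass k * ?d k) \<le> cost \<beta>"
        by (rule sum_le_cost) (use fin ne in auto)
      then have "1/4 * (2 - a)\<^sup>2 + 1/2 * (3 - a)\<^sup>2 \<le> cost \<beta>"
        using near[OF a(1)] near[OF a(2)] by simp
      moreover have "1/4 * (2 - a)\<^sup>2 + 1/2 * (3 - a)\<^sup>2 = 3/4 * (a - 8/3)\<^sup>2 + 1/6"
        by (simp add: power2_eq_square field_simps)
      ultimately show ?thesis using zero_le_power2[of "a - 8/3"] by linarith
    next
      case no23: True
      show ?thesis
      \<comment> \<open>The pair 3, 5 is tested before 3, 4, since a point shared by 3 and 4 is
        harmful enough only once the tail from 5 is known to avoid the points serving 3.\<close>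
      proof (cases "nearest \<beta> 3 \<inter> nearest \<beta> 5 = {}")
        case False
        then obtain a where a: "a \<in> nearest \<beta> 3" "a \<in> nearest \<beta> 5" by auto
        have a4: "a \<in> nearest \<beta> 4"
          using nearest_between[OF fin a, of 4] by simp
        have "(\<Sum>k\<in>{3,4,5}. mass k * ?d k) \<le> cost \<beta>"
          by (rule sum_le_cost) (use fin ne in auto)
        then have "1/2 * (3 - a)\<^sup>2 + 1/16 * (4 - a)\<^sup>2 + 1/32 * (5 - a)\<^sup>2 \<le> cost \<beta>"
          using near[OF a(1)] near[OF a4] near[OF a(2)] by simp
        moreover have "1/2 * (3 - a)\<^sup>2 + 1/16 * (4 - a)\<^sup>2 + 1/32 * (5 - a)\<^sup>2
            = 19/32 * (a - 61/19)\<^sup>2 + 49/304"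
          by (simp add: power2_eq_square field_simps)
        ultimately show ?thesis using zero_le_power2[of "a - 61/19"] by linarith
      next
        case no35: True
        show ?thesis
        proof (cases "nearest \<beta> 3 \<inter> nearest \<beta> 4 = {}")
          case False
          then obtain a where a: "a \<in> nearest \<beta> 3" "a \<in> nearest \<beta> 4" by auto
          have "(\<Sum>k. (1/2)^k * sq_dist \<beta> (real (5 + k))) \<ge> 4/3"
          proof -
            have "4 \<le> (5::nat)" "nearest \<beta> 3 \<inter> nearest \<beta> (real 5) = {}" using no35 by auto
            then show ?thesis
              by (rule tail_two_means[OF fin ne card _ no12 no23])
          qed
          \<comment> \<open>The tail contributes \<open>(1/2)^5 * 4/3 = 1/24\<close>; with the 1/18
            below this gives 7/72, above 1/12.\<close>
          then have "cost \<beta> \<ge> 1/2 * (3 - a)\<^sup>2 + 1/16 * (4 - a)\<^sup>2 + 1/24"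
            using cost_split[OF fin ne, of 5] init init' nonneg[of 1] nonneg[of 2]
              near[OF a(1)] near[OF a(2)] by (simp add: power_one_over)
          moreover have "1/2 * (3 - a)\<^sup>2 + 1/16 * (4 - a)\<^sup>2 = 9/16 * (a - 28/9)\<^sup>2 + 1/18"
            by (simp add: power2_eq_square field_simps)
          ultimately show ?thesis using zero_le_power2[of "a - 28/9"] by linarith
        next
          case no34: True
          have "nearest \<beta> 3 \<inter> nearest \<beta> (real 4) = {}" using no34 by simp
          then obtain a1 a2 a3 b c where
            a: "a1 \<in> nearest \<beta> 1" "a2 \<in> nearest \<beta> 2" "a3 \<in> nearest \<beta> 3"
            and \<beta>: "\<beta> = {a1, a2, a3, b, c}"
            and tail: "(\<Sum>k. (1/2)^k * sq_dist \<beta> (real (4 + k))) \<ge> 4/3"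
              "(\<Sum>k. (1/2)^k * sq_dist \<beta> (real (4 + k))) = 4/3
                \<Longrightarrow> b = real 4 + 1/3 \<and> c = real 4 + 3"
            by (rule tail_two_means[OF fin ne card order_refl no12 no23]) (rule that; assumption)
          have cost: "cost \<beta> = 1/8 * (1 - a1)\<^sup>2 + 1/4 * (2 - a2)\<^sup>2 + 1/2 * (3 - a3)\<^sup>2
              + 1/16 * (\<Sum>k. (1/2)^k * sq_dist \<beta> (real (4 + k)))"
            using cost_split[OF fin ne, of 4] init near[OF a(1)] near[OF a(2)] near[OF a(3)]
            by (simp add: power_one_over)
          show ?thesis
          proof (cases "cost \<beta> > 1/12")
            case False
            \<comment> \<open>The tail alone costs at least \<open>1/16 * 4/3 = 1/12\<close>, so
              nothing remains for 1, 2 and 3, and the tail bound is attained.\<close>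
            then have eq: "(1 - a1)\<^sup>2 = 0 \<and> (2 - a2)\<^sup>2 = 0 \<and> (3 - a3)\<^sup>2 = 0
              \<and> (\<Sum>k. (1/2)^k * sq_dist \<beta> (real (4 + k))) = 4/3"
              using cost tail(1) zero_le_power2[of "1 - a1"] zero_le_power2[of "2 - a2"]
                zero_le_power2[of "3 - a3"] by linarith
            then have "a1 = 1" "a2 = 2" "a3 = 3" by auto
            moreover have "b = 13/3" "c = 7" using tail(2) eq by auto
            ultimately have "\<beta> = {1, 2, 3, 13/3, 7}" using \<beta> by metis
            moreover have "cost \<beta> = 1/12" unfolding cost using eq by (elim conjE) simp
            ultimately show ?thesis by blast
          qed simp
        qed
      qed
    qed
  qed
qed

section \<open>Attainment and the optimal set\<close>

text \<open>An upper bound suffices, since \<open>cost_five_means\<close> excludes smaller values.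
  Assigning each atom some point of the set gives one, without checking that this point is
  nearest.\<close>

lemma cost_optimal: "cost {1, 2, 3, 13/3, 7} = 1/12"
proof -
  let ?A = "{1, 2, 3, 13/3, 7} :: real set"
  let ?f = "\<lambda>n. mass n * sq_dist ?A (real n)"
  have fin: "finite ?A" "?A \<noteq> {}" "card ?A \<le> 5" by (auto simp: card_insert_if)
  note le = sq_dist_le[OF fin(1)]
  \<comment> \<open>The atom \<open>6 + k\<close> is assigned to 7, at distance
    \<open>\<bar>k - 1\<bar>\<close>; the weight of 6 is 1/64.\<close>
  have "(\<lambda>k. 1/64 * ((1/2)^k * (real k - 1)\<^sup>2)) sums (1/64 * (4 + 2 * (1 - 1)\<^sup>2))"
    by (intro sums_mult sums_half_quadratic)
  then have s: "(\<lambda>k. 1/64 * ((1/2)^k * (real k - 1)\<^sup>2)) sums (1/16)" by simp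
  have "(\<Sum>k. ?f (k + 6)) \<le> (\<Sum>k. 1/64 * ((1/2)^k * (real k - 1)\<^sup>2))"
  proof (rule suminf_le)
    show "?f (k + 6) \<le> 1/64 * ((1/2)^k * (real k - 1)\<^sup>2)" for k
      using le[of 7 "real (k + 6)"] by (simp add: mass_tail power_add power_one_over field_simps)
    show "summable (\<lambda>k. ?f (k + 6))"
      by (rule summable_ignore_initial_segment[OF summable_cost[OF fin(1,2)]])
    show "summable (\<lambda>k. 1/64 * ((1/2)^k * (real k - 1)\<^sup>2))"
      using s by (rule sums_summable)
  qed
  also have "\<dots> = 1/16" using s by (rule sums_unique[symmetric])
  finally have "(\<Sum>k. ?f (k + 6)) \<le> 1/16" .
  moreover have "(\<Sum>n<6. ?f n) = 1/8 * sq_dist ?A 1 + 1/4 * sq_dist ?A 2 + 1/2 * sq_dist ?A 3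
      + 1/16 * sq_dist ?A 4 + 1/32 * sq_dist ?A 5"
  proof -
    have "{..<6::nat} = {0, 1, 2, 3, 4, 5}" by auto
    then show ?thesis by simp
  qed
  moreover have "sq_dist ?A 1 \<le> 0" "sq_dist ?A 2 \<le> 0" "sq_dist ?A 3 \<le> 0"
    "sq_dist ?A 4 \<le> 1/9" "sq_dist ?A 5 \<le> 4/9"
    using le[of 1 1] le[of 2 2] le[of 3 3] le[of "13/3" 4] le[of "13/3" 5]
    by (simp_all add: power2_eq_square)
  ultimately have "cost ?A \<le> 1/12"
    unfolding cost_def using suminf_split_initial_segment[OF summable_cost[OF fin(1,2)], of 6]
    by linarith
  then show ?thesis using cost_five_means[OF fin] by linarith
qed

theorem proposition4p2p4:
  shows "optimal_set_of_means 5 P {1, 2, 3, Av P 4 5, Av_inf P 6}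
       \<and> (\<forall>\<beta>. optimal_set_of_means 5 P \<beta> \<longrightarrow> \<beta> = {1, 2, 3, Av P 4 5, Av_inf P 6})
       \<and> quantization_error 5 P = ennreal (1 / 12)"
proof -
  let ?A = "{1, 2, 3, 13/3, 7} :: real set"
  let ?F = "{\<alpha>. finite \<alpha> \<and> 1 \<le> card \<alpha> \<and> card \<alpha> \<le> 5} :: real set set"
  have A: "?A \<in> ?F" by (auto simp: card_insert_if)
  have dist: "distortion P \<beta> = ennreal (cost \<beta>)" if "\<beta> \<in> ?F" for \<beta>
    using that by (intro distortion_P) auto
  have five: "cost \<beta> > 1/12 \<or> cost \<beta> = 1/12 \<and> \<beta> = ?A" if "\<beta> \<in> ?F" for \<beta>
    using that by (intro cost_five_means) auto
  have Q: "quantization_error 5 P = ennreal (1/12)"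
    unfolding quantization_error_def
  proof (rule antisym)
    show "(INF \<alpha>\<in>?F. distortion P \<alpha>) \<le> ennreal (1/12)"
      by (rule INF_lower2[OF A]) (use dist[OF A] cost_optimal in simp)
    show "ennreal (1/12) \<le> (INF \<alpha>\<in>?F. distortion P \<alpha>)"
    proof (rule INF_greatest)
      fix \<beta> assume "\<beta> \<in> ?F"
      then show "ennreal (1/12) \<le> distortion P \<beta>"
        using dist five by (fastforce intro: ennreal_leI)
    qed
  qed
  have "optimal_set_of_means 5 P ?A"
    using A dist[OF A] Q cost_optimal by (simp add: optimal_set_of_means_def)
  moreover have "\<beta> = ?A" if "optimal_set_of_means 5 P \<beta>" for \<beta>
  proof -
    have \<beta>: "\<beta> \<in> ?F" and "distortion P \<beta> = ennreal (1/12)"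
      using that Q by (auto simp: optimal_set_of_means_def)
    then have eq: "ennreal (cost \<beta>) = ennreal (1/12)" using dist by simp
    \<comment> \<open>\<open>ennreal\<close> sends all negative reals to 0, so it can be cancelled
      only between nonnegative values.\<close>
    have "cost \<beta> \<ge> 0" using five[OF \<beta>] by linarith
    then have "cost \<beta> = 1/12" using eq by (subst (asm) ennreal_inj) auto
    then show ?thesis using five[OF \<beta>] by simp
  qed
  ultimately show ?thesis
    unfolding Av_4_5 Av_inf_6 using Q by blast
qed

end
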